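(* Let $l\in\mathbb{N}$, let $(X,\mathcal{T}_1,\ldots,\mathcal{T}_l)$ be a rational dynamical system, let $k\in\mathbb{N}$ and let $k_1<k_2$ be arbitrary real numbers. For every $\varepsilon>0$ there exist $\beta\in\mathbb{Q}\setminus\mathbb{Z}$ and $\gamma\in\mathbb{Z}^\ast$ with $dom^+(\beta)=\emptyset=dom^-(\gamma)$ and $\max dom^-(\beta)<k_1<k_2<\min dom^+(\gamma)$, and there exists $x_0\in X$, such that $\mathcal{T}_i^{p\beta+q\gamma}(x_0)\in B(x_0,\varepsilon)$ for all integers $0\leq p,q\leq k$ and all $1\leq i\leq l$.
   Context: Notation: $\mathbb{N}=\{1,2,\ldots\}$, $\mathbb{Z}^\ast=\mathbb{Z}\setminus\{0\}$; $B(x,\varepsilon)$ is the open ball of radius $\varepsilon$ about $x$. Expansion of rationals: every rational number $q$ has a unique expression $q=\sum_{s=1}^{\infty}q_{-s}\frac{(-1)^{s}}{(s+1)!}+\sum_{r=1}^{\infty}q_{r}(-1)^{r+1}r!$ with integers $0\leq q_{-s}\leq s$ for $s\geq 1$ and $0\leq q_r\leq r$ for $r\geq 1$, all but finitely many of which are zero. Put $dom(q)=\{t\in\mathbb{Z}^\ast: q_t\neq 0\}$, $dom^-(q)=\{t\in dom(q): t<0\}$, $dom^+(q)=\{t\in dom(q): t>0\}$. Rational indexed family: given a family $\{T_n\}_{n\in\mathbb{Z}^\ast}$ of pairwise commuting continuous maps $X\to X$, for a non-zero rational $q$ with $dom(q)=\{t_1<\ldots<t_m\}$ put $\mathcal{T}^q(x)=T_{t_1}^{q_{t_1}}\cdots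 T_{t_m}^{q_{t_m}}(x)$, and put $\mathcal{T}^0(x)=x$. Then $\mathcal{T}=(\mathcal{T}^q)_{q\in\mathbb{Q}}$ is the rational indexed family defined from $\{T_n\}_{n\in\mathbb{Z}^\ast}$. Rational dynamical system: $(X,\mathcal{T}_1,\ldots,\mathcal{T}_l)$ where $X$ is a non-empty compact metric space and, for $1\leq i\leq l$, $\mathcal{T}_i$ is the rational indexed family defined from a family $\{T_{i,n}\}_{n\in\mathbb{Z}^\ast}$ of homeomorphisms of $X$ onto itself, such that $T_{i,n_1}T_{j,n_2}=T_{j,n_2}T_{i,n_1}$ for all $1\leq i,j\leq l$ and $n_1,n_2\in\mathbb{Z}^\ast$. *)

theory Defs
  imports "HOL-Analysis.Analysis"
begin

text \<open>
  \<open>rat_expansion q d\<close>: the digits \<open>d t\<close> (indexed by the non-zero integers, extended by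
  \<open>d 0 = 0\<close>) expand \<open>q\<close> as
  \<open>\<Sum>\<^sub>s q\<^bsub>-s\<^esub> (-1)^s / (s+1)! + \<Sum>\<^sub>r q\<^bsub>r\<^esub> (-1)^(r+1) r!\<close>.
  All but finitely many digits vanish, so both series are written as sums over the
  non-zero digits, which form a finite set.
\<close>

definition rat_expansion :: "rat \<Rightarrow> (int \<Rightarrow> nat) \<Rightarrow> bool" where
  "rat_expansion q d \<longleftrightarrow>
     finite {t. d t \<noteq> 0} \<and> d 0 = 0 \<and>
     (\<forall>s\<ge>1. d (- int s) \<le> s) \<and> (\<forall>r\<ge>1. d (int r) \<le> r) \<and>
     q = (\<Sum>s | 1 \<le> s \<and> d (- int s) \<noteq> 0. of_nat (d (- int s)) * ((-1) ^ s / fact (s + 1)))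
       + (\<Sum>r | 1 \<le> r \<and> d (int r) \<noteq> 0. of_nat (d (int r)) * ((-1) ^ (r + 1) * fact r))"

text \<open>Every rational has exactly one expansion, so the description below is proper.\<close>

definition rat_digit :: "rat \<Rightarrow> int \<Rightarrow> nat" where
  "rat_digit q = (THE d. rat_expansion q d)"

definition rat_dom :: "rat \<Rightarrow> int set" where
  "rat_dom q = {t. t \<noteq> 0 \<and> rat_digit q t \<noteq> 0}"

definition rat_dom_neg :: "rat \<Rightarrow> int set" where
  "rat_dom_neg q = {t \<in> rat_dom q. t < 0}"

definition rat_dom_pos :: "rat \<Rightarrow> int set" where
  "rat_dom_pos q = {t \<in> rat_dom q. t > 0}"

definition rat_family :: "(int \<Rightarrow> 'a \<Rightarrow> 'a) \<Rightarrow> rat \<Rightarrow> 'a \<Rightarrow> 'a" where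
  "rat_family T q =
     foldr (\<lambda>t f. (T t ^^ rat_digit q t) \<circ> f) (sorted_list_of_set (rat_dom q)) id"

text \<open>
  The space is a set \<open>X\<close> in a metric type, with the induced metric. The maps \<open>T i n\<close> are
  relevant only for \<open>1 \<le> i \<le> l\<close> and \<open>n \<noteq> 0\<close>, and only on \<open>X\<close>.
\<close>

definition rational_dynamical_system ::
    "'a::metric_space set \<Rightarrow> nat \<Rightarrow> (nat \<Rightarrow> int \<Rightarrow> 'a \<Rightarrow> 'a) \<Rightarrow> bool" where
  "rational_dynamical_system X l T \<longleftrightarrow>
     X \<noteq> {} \<and> compact X \<and>
     (\<forall>i\<in>{1..l}. \<forall>n. n \<noteq> 0 \<longrightarrow> (\<exists>S. homeomorphism X X (T i n) S)) \<and>
     (\<forall>i\<in>{1..l}. \<forall>j\<in>{1..l}. \<forall>m n. m \<noteq> 0 \<longrightarrow> n \<noteq> 0 \<longrightarrow>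
        (\<forall>x\<in>X. T i m (T j n x) = T j n (T i m x)))"

end

theory Submission imports Defs begin

text \<open>
  For a finite set \<open>F\<close> of indices \<open>n \<ge> k\<close> put \<open>\<beta> = \<Sum>s\<in>F. (-1)^s / (s+1)!\<close> and
  \<open>\<gamma> = \<Sum>r\<in>F. (-1)^(r+1) r!\<close>. For \<open>p, q \<le> k\<close> no carries occur in \<open>p \<beta> + q \<gamma>\<close>, so this number
  acts under \<open>T i\<close> as the product over \<open>n \<in> F\<close> of the commuting maps
  \<open>C n (i, p, q) = (T i (-n))^p (T i n)^q\<close>.
  Fix a point \<open>x\<close> and let a word \<open>w\<close> over the finite alphabet of triples \<open>(i, p, q)\<close> act on it by
  composing the maps \<open>C n (w n)\<close>. Colour \<open>w\<close> by a small ball that contains the image of \<open>x\<close>. The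
  Hales-Jewett theorem gives a monochromatic variable word; \<open>F\<close> is the set of positions of its
  variable, and its constant letters move \<open>x\<close> to the required point \<open>x0\<close>.
\<close>

section \<open>Words, variable words and the Hales-Jewett property\<close>

definition words :: "'a set \<Rightarrow> nat \<Rightarrow> 'a list set" where
  "words A n = {w. set w \<subseteq> A \<and> length w = n}"

text \<open>\<open>None\<close> stands for the variable.\<close>

definition variable_words :: "'a set \<Rightarrow> nat \<Rightarrow> 'a option list set" where
  "variable_words A n = {v. set v \<subseteq> insert None (Some ` A) \<and> length v = n \<and> None \<in> set v}"

definition fill :: "'a \<Rightarrow> 'a option list \<Rightarrow> 'a list" where
  "fill x v = map (case_option x id) v"

definition monochromatic :: "'a set \<Rightarrow> ('a list \<Rightarrow> 'b) \<Rightarrow> 'a option list \<Rightarrow> bool" where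
  "monochromatic A c v \<longleftrightarrow> (\<forall>x\<in>A. \<forall>y\<in>A. c (fill x v) = c (fill y v))"

text \<open>Colours are natural numbers because a definition cannot quantify over a type of colours;
  \<open>hales_jewett_finite_range\<close> passes to an arbitrary finite set of colours.\<close>

definition hales_jewett :: "'a set \<Rightarrow> nat \<Rightarrow> nat \<Rightarrow> bool" where
  "hales_jewett A r n \<longleftrightarrow>
     (\<forall>c :: 'a list \<Rightarrow> nat. c ` words A n \<subseteq> {..<r} \<longrightarrow>
        (\<exists>v\<in>variable_words A n. monochromatic A c v))"

lemma finite_words: "finite A \<Longrightarrow> finite (words A n)"
  unfolding words_def by (rule finite_lists_length_eq)

lemma append_in_words: "u \<in> words A m \<Longrightarrow> w \<in> words A n \<Longrightarrow> u @ w \<in> words A (m + n)"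
  by (auto simp: words_def)

lemma words_mono: "A \<subseteq> B \<Longrightarrow> words A n \<subseteq> words B n"
  by (auto simp: words_def)

lemma fill_in_words: "v \<in> variable_words A n \<Longrightarrow> x \<in> A \<Longrightarrow> fill x v \<in> words A n"
  by (fastforce simp: words_def variable_words_def fill_def split: option.splits)

lemma fill_append [simp]: "fill x (v @ w) = fill x v @ fill x w"
  by (simp add: fill_def)

lemma fill_const [simp]: "fill x (map Some w) = w"
  by (simp add: fill_def comp_def)

lemma variable_words_mono: "A \<subseteq> B \<Longrightarrow> variable_words A n \<subseteq> variable_words B n"
  by (auto simp: variable_words_def)

lemma variable_words_append:
  assumes "v \<in> variable_words A m" "w \<in> variable_words A n"
  shows "v @ w \<in> variable_words A (m + n)"
  using assms by (auto simp: variable_words_def)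

lemma variable_words_append_const:
  assumes "v \<in> variable_words A m" "w \<in> words A n"
  shows "v @ map Some w \<in> variable_words A (m + n)"
  using assms by (auto simp: variable_words_def words_def)

lemma variable_words_const_append:
  assumes "u \<in> words A m" "v \<in> variable_words A n"
  shows "map Some u @ v \<in> variable_words A (m + n)"
  using assms by (auto simp: variable_words_def words_def)

text \<open>Numbering \<open>K\<close> by a bijection \<open>h\<close> gives numerical colours, and
  injectivity of \<open>h\<close> on \<open>K\<close> carries the monochromatic word back. The
  general colour type serves colours that are functions (colour focusing) or centres of balls
  (recurrence).\<close>

lemma hales_jewett_finite_range:
  fixes c :: "'a list \<Rightarrow> 'b"
  assumes "hales_jewett A (card K) n" "finite K" "c ` words A n \<subseteq> K"
  shows "\<exists>v\<in>variable_words A n. monochromatic A c v"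
proof -
  obtain h where h: "bij_betw h K {0..<card K}"
    using ex_bij_betw_finite_nat[OF assms(2)] by blast
  have "(h \<circ> c) ` words A n \<subseteq> {..<card K}"
    using h assms(3) by (fastforce simp: bij_betw_def)
  then obtain v where v: "v \<in> variable_words A n" "monochromatic A (h \<circ> c) v"
    using assms(1) unfolding hales_jewett_def by blast
  have "monochromatic A c v"
    unfolding monochromatic_def
  proof (intro ballI)
    fix x y assume "x \<in> A" "y \<in> A"
    moreover from this have "c (fill x v) \<in> K" "c (fill y v) \<in> K"
      using assms(3) fill_in_words[OF v(1)] by blast+
    moreover from calculation have "h (c (fill x v)) = h (c (fill y v))"
      using v(2) unfolding monochromatic_def comp_def by blast
    ultimately show "c (fill x v) = c (fill y v)"
      using h by (meson bij_betw_def inj_onD)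
  qed
  then show ?thesis using v(1) by blast
qed

section \<open>Colour focusing and the Hales-Jewett theorem\<close>

text \<open>Recording colours instead of words makes \<open>card S\<close> count distinct colours
  focused at \<open>f\<close>; the colour of \<open>f\<close> itself is left open.\<close>

definition focused :: "'a set \<Rightarrow> 'a \<Rightarrow> nat \<Rightarrow> ('a list \<Rightarrow> nat) \<Rightarrow> 'a list \<Rightarrow> nat set \<Rightarrow> bool" where
  "focused A a n c f S \<longleftrightarrow>
     (\<forall>k\<in>S. \<exists>v\<in>variable_words (insert a A) n. fill a v = f \<and> (\<forall>x\<in>A. c (fill x v) = k))"

text \<open>Colour focusing: \<open>S\<close> collects the colours of variable words that are monochromatic on \<open>A\<close> and
  all become \<open>f\<close> at the extra letter \<open>a\<close>. As long as no word is monochromatic on \<open>insert a A\<close>, the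
  colour of \<open>f\<close> is not in \<open>S\<close>, so \<open>S\<close> can be enlarged.\<close>

lemma colour_focusing:
  fixes A :: "'a set"
  assumes "finite A" "A \<noteq> {}" and hj: "\<And>r. \<exists>n. hales_jewett A r n"
  shows "\<exists>n. \<forall>c :: 'a list \<Rightarrow> nat. c ` words (insert a A) n \<subseteq> {..<r} \<longrightarrow>
           (\<exists>v\<in>variable_words (insert a A) n. monochromatic (insert a A) c v) \<or>
           (\<exists>f\<in>words (insert a A) n. \<exists>S\<subseteq>{..<r}. card S = s \<and> focused A a n c f S)"
proof (induction s)
  case 0
  have "[] \<in> words (insert a A) 0" by (simp add: words_def)
  moreover have "{} \<subseteq> {..<r} \<and> card ({} :: nat set) = 0" by simp
  moreover have "focused A a 0 c [] {}" for c by (simp add: focused_def)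
  ultimately show ?case by blast
next
  case (Suc s)
  let ?B = "insert a A"
  from Suc obtain n where n: "\<And>c :: 'a list \<Rightarrow> nat. c ` words ?B n \<subseteq> {..<r} \<Longrightarrow>
      \<not> (\<exists>v\<in>variable_words ?B n. monochromatic ?B c v) \<Longrightarrow>
      (\<exists>f\<in>words ?B n. \<exists>S\<subseteq>{..<r}. card S = s \<and> focused A a n c f S)"
    by blast
  \<comment> \<open>A prefix of length \<open>m\<close> is coloured by the entire colouring that it
    induces on suffixes of length \<open>n\<close>. These colourings form the finite set
    \<open>K\<close>, so Hales-Jewett over \<open>A\<close> is invoked with \<open>card K\<close>
    colours.\<close>
  define K where "K = (words ?B n \<rightarrow>\<^sub>E {..<r})"
  have K: "finite K"
    unfolding K_def using assms(1) by (intro finite_PiE finite_words) auto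
  obtain m where m: "hales_jewett A (card K) m" using hj by blast
  obtain b where b: "b \<in> A" using assms(2) by blast
  show ?case
  proof (intro exI[of _ "m + n"] allI impI, rule disjCI)
    fix c :: "'a list \<Rightarrow> nat"
    assume c: "c ` words ?B (m + n) \<subseteq> {..<r}"
      and no: "\<not> (\<exists>f\<in>words ?B (m + n). \<exists>S\<subseteq>{..<r}. card S = Suc s \<and>
         focused A a (m + n) c f S)"
    show "\<exists>v\<in>variable_words ?B (m + n). monochromatic ?B c v"
    proof (rule ccontr)
      assume nm: "\<not> (\<exists>v\<in>variable_words ?B (m + n). monochromatic ?B c v)"
      have "(\<lambda>u. \<lambda>w\<in>words ?B n. c (u @ w)) ` words A m \<subseteq> K"
        unfolding K_def using c words_mono[of A ?B m]
        by (auto simp: image_subset_iff intro!: append_in_words)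
      from hales_jewett_finite_range[OF m K this]
      obtain V where V: "V \<in> variable_words A m"
        and Vm: "monochromatic A (\<lambda>u. \<lambda>w\<in>words ?B n. c (u @ w)) V" by blast
      have V': "V \<in> variable_words ?B m"
        using V variable_words_mono[of A ?B m] by auto
      \<comment> \<open>All fillings of \<open>V\<close> by letters of \<open>A\<close> induce the
        same colouring of suffixes, so the letter \<open>b\<close> can stand for each of
        them.\<close>
      have Vc: "c (fill x V @ w) = c (fill b V @ w)" if "x \<in> A" "w \<in> words ?B n" for x w
        using Vm that b unfolding monochromatic_def by (metis (no_types, lifting) restrict_apply')
      have bV: "fill b V \<in> words ?B m" using fill_in_words[OF V'] b by blast
      define c' where "c' w = c (fill b V @ w)" for w
      have "c' ` words ?B n \<subseteq> {..<r}"
        using c append_in_words[OF bV] by (auto simp: c'_def)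
      moreover have nm': "\<not> (\<exists>v\<in>variable_words ?B n. monochromatic ?B c' v)"
      proof
        assume "\<exists>v\<in>variable_words ?B n. monochromatic ?B c' v"
        then obtain v where "v \<in> variable_words ?B n" "monochromatic ?B c' v"
          by blast
        moreover have "monochromatic ?B c (map Some (fill b V) @ v) = monochromatic ?B c' v"
          by (simp add: monochromatic_def c'_def)
        ultimately show False
          using nm variable_words_const_append[OF bV] by blast
      qed
      ultimately obtain f S where f: "f \<in> words ?B n" and S: "S \<subseteq> {..<r}" "card S = s"
        and "focused A a n c' f S"
        using n[of c'] by blast
      then have foc: "\<exists>v\<in>variable_words ?B n. fill a v = f \<and> (\<forall>x\<in>A. c' (fill x v) = k)"
        if "k \<in> S" for k
        using that by (simp add: focused_def)
      have "c' f \<notin> S"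
      proof
        assume "c' f \<in> S"
        from foc[OF this] obtain v where "v \<in> variable_words ?B n" "fill a v = f"
          "\<forall>x\<in>A. c' (fill x v) = c' f" by blast
        then have "c' (fill x v) = c' f" if "x \<in> ?B" for x
          using that by (elim insertE) simp_all
        then have "monochromatic ?B c' v" unfolding monochromatic_def by metis
        with \<open>v \<in> variable_words ?B n\<close> nm' show False by blast
      qed
      moreover have "finite S" using S(1) finite_subset by blast
      ultimately have "card (insert (c' f) S) = Suc s" using S(2) by simp
      moreover have "insert (c' f) S \<subseteq> {..<r}"
        using S(1) \<open>c' ` words ?B n \<subseteq> {..<r}\<close> f by auto
      moreover have "fill a V @ f \<in> words ?B (m + n)"
        using append_in_words[OF fill_in_words[OF V'] f] by blast
      \<comment> \<open>The old colours come from words \<open>V @ v\<close>, the new colour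
        \<open>c' f\<close> from \<open>V @ map Some f\<close>; at the letter \<open>a\<close> all
        of them become \<open>fill a V @ f\<close>.\<close>
      moreover have "focused A a (m + n) c (fill a V @ f) (insert (c' f) S)"
        unfolding focused_def
      proof
        fix k assume k: "k \<in> insert (c' f) S"
        show "\<exists>v\<in>variable_words ?B (m + n).
          fill a v = fill a V @ f \<and> (\<forall>x\<in>A. c (fill x v) = k)"
        proof (cases "k \<in> S")
          case True
          from foc[OF this] obtain v where v: "v \<in> variable_words ?B n" "fill a v = f"
            "\<forall>x\<in>A. c' (fill x v) = k" by blast
          have "c (fill x (V @ v)) = k" if "x \<in> A" for x
            using Vc[OF that fill_in_words[OF v(1)]] v(3) that by (simp add: c'_def)
          then show ?thesis
            using v(2) variable_words_append[OF V' v(1)] by (intro bexI[of _ "V @ v"] conjI ballI) simp_all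
        next
          case False
          then have "c (fill x (V @ map Some f)) = k" if "x \<in> A" for x
            using Vc[OF that f] k by (simp add: c'_def)
          then show ?thesis
            using variable_words_append_const[OF V' f]
            by (intro bexI[of _ "V @ map Some f"] conjI ballI) simp_all
        qed
      qed
      ultimately show False using no by blast
    qed
  qed
qed

text \<open>Induction on the alphabet, for all numbers of colours at once, since focusing uses the
  smaller alphabet with a different number of colours. Taking \<open>s = Suc r\<close> in
  \<open>colour_focusing\<close> excludes its second alternative: there are only \<open>r\<close>
  colours.\<close>

theorem hales_jewett_theorem:
  fixes A :: "'a set"
  assumes "finite A" "A \<noteq> {}"
  shows "\<exists>n. hales_jewett A r n"
  using assms
proof (induction arbitrary: r rule: finite_ne_induct)
  case (singleton a)
  have "[None] \<in> variable_words {a} 1"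
    by (simp add: variable_words_def)
  then have "hales_jewett {a} r 1"
    unfolding hales_jewett_def monochromatic_def by blast
  then show ?case by blast
next
  case (insert a A)
  obtain n where n: "\<forall>c :: 'a list \<Rightarrow> nat. c ` words (insert a A) n \<subseteq> {..<r} \<longrightarrow>
      (\<exists>v\<in>variable_words (insert a A) n. monochromatic (insert a A) c v) \<or>
      (\<exists>f\<in>words (insert a A) n. \<exists>S\<subseteq>{..<r}. card S = Suc r \<and> focused A a n c f S)"
    using colour_focusing[OF insert.hyps(1,2) insert.IH, of a r "Suc r"] ..
  have "card S \<noteq> Suc r" if "S \<subseteq> {..<r}" for S
    using card_mono[OF _ that] by auto
  with n have "hales_jewett (insert a A) r n"
    unfolding hales_jewett_def by blast
  then show ?case ..
qed

section \<open>Uniqueness of the expansion of a rational\<close>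

text \<open>The digit bounds enter through this fact: two digits at index \<open>b\<close> differ by
  at most \<open>b\<close>, so a difference divisible by \<open>b + 1\<close> vanishes.\<close>

lemma eq_0_of_dvd:
  fixes x :: int
  assumes "int b + 1 dvd x" "\<bar>x\<bar> \<le> int b"
  shows "x = 0"
proof (rule ccontr)
  assume "x \<noteq> 0"
  from dvd_imp_le_int[OF this assms(1)] assms(2) show False by linarith
qed

text \<open>The largest index \<open>b\<close> is treated first: after multiplication by
  \<open>b!\<close> every term with \<open>s < b\<close> is an integer, because
  \<open>(s + 1)!\<close> divides \<open>b!\<close>. Hence \<open>e b / (b + 1)\<close> is an
  integer and \<open>e b\<close> vanishes.\<close>

lemma digits_zero_of_fractional_sum:
  fixes e :: "nat \<Rightarrow> int"
  assumes "finite F" "\<And>s. s \<in> F \<Longrightarrow> \<bar>e s\<bar> \<le> int s"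
    and "(\<Sum>s\<in>F. of_int (e s) / fact (s + 1) :: rat) \<in> \<int>"
  shows "\<forall>s\<in>F. e s = 0"
  using assms
proof (induction rule: finite_linorder_max_induct)
  case empty
  then show ?case by simp
next
  case (insert b A)
  let ?\<sigma> = "\<Sum>s\<in>A. of_int (e s) / fact (s + 1) :: rat"
  have b: "b \<notin> A" using insert.hyps by blast
  have "fact b * ?\<sigma> \<in> \<int>"
    unfolding sum_distrib_left
  proof (rule Ints_sum)
    fix s assume "s \<in> A"
    then have "(fact (s + 1) :: int) dvd fact b" using insert.hyps by (intro fact_dvd) auto
    then obtain j :: int where j: "fact b = fact (s + 1) * j" by (rule dvdE)
    have "(fact b :: rat) = of_int (fact b)" by simp
    also have "\<dots> = fact (s + 1) * of_int j" unfolding j by simp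
    finally have "fact b * (of_int (e s) / fact (s + 1)) = (of_int (j * e s) :: rat)"
      by (simp add: field_simps del: fact_Suc)
    then show "fact b * (of_int (e s) / fact (s + 1)) \<in> (\<int> :: rat set)" by simp
  qed
  moreover have "fact b * (of_int (e b) / fact (b + 1) + ?\<sigma>) \<in> (\<int> :: rat set)"
    using insert.prems(2) b insert.hyps(1) by (intro Ints_mult fact_in_Ints) (simp del: fact_Suc)
  ultimately have "fact b * (of_int (e b) / fact (b + 1) + ?\<sigma>) - fact b * ?\<sigma> \<in> \<int>"
    by (rule Ints_diff[rotated])
  then have "of_int (e b) / (of_nat b + 1) \<in> (\<int> :: rat set)"
    by (simp add: distrib_left add.commute)
  then obtain j where "of_int (e b) / (of_nat b + 1) = (of_int j :: rat)" by (rule Ints_cases)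
  then have "of_int (e b) = (of_int (j * (int b + 1)) :: rat)"
    by (simp add: divide_eq_eq add_nonneg_eq_0_iff)
  then have "e b = j * (int b + 1)" by (simp only: of_int_eq_iff)
  then have "(int b + 1) dvd e b" by simp
  then have eb: "e b = 0" by (rule eq_0_of_dvd) (simp add: insert.prems(1))
  then have "?\<sigma> \<in> \<int>" using insert.prems(2) b insert.hyps(1) by simp
  then have "\<forall>s\<in>A. e s = 0" using insert.prems(1) by (intro insert.IH) simp_all
  then show ?case using eb by simp
qed

text \<open>Here the smallest index \<open>b\<close> is treated first: all other terms are divisible
  by \<open>(b + 1)!\<close>, so \<open>b + 1\<close> divides \<open>e b\<close>.\<close>

lemma digits_zero_of_factorial_sum:
  fixes e :: "nat \<Rightarrow> int"
  assumes "finite F" "\<And>r. r \<in> F \<Longrightarrow> \<bar>e r\<bar> \<le> int r"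
    and "(\<Sum>r\<in>F. e r * fact r) = 0"
  shows "\<forall>r\<in>F. e r = 0"
  using assms
proof (induction rule: finite_linorder_min_induct)
  case empty
  then show ?case by simp
next
  case (insert b A)
  have b: "b \<notin> A" using insert.hyps by blast
  have "(fact (Suc b) :: int) dvd (\<Sum>r\<in>A. e r * fact r)"
    using insert.hyps by (intro dvd_sum dvd_mult fact_dvd) auto
  moreover have "e b * fact b = - (\<Sum>r\<in>A. e r * fact r)"
    using insert.prems(2) insert.hyps(1) b by simp
  ultimately have "fact b * (int b + 1) dvd fact b * e b"
    by (simp add: algebra_simps)
  then have "(int b + 1) dvd e b" by simp
  then have eb: "e b = 0" by (rule eq_0_of_dvd) (simp add: insert.prems(1))
  then have "(\<Sum>r\<in>A. e r * fact r) = 0" using insert.prems(2) b insert.hyps(1) by simp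
  then have "\<forall>r\<in>A. e r = 0" using insert.prems(1) by (intro insert.IH) simp_all
  then show ?case using eb by simp
qed

text \<open>Enlarging the index set adds only zero digits, so two expansions can be written over a
  common \<open>F\<close> and subtracted term by term. The second sum is a cast integer, which makes
  its integrality visible.\<close>

lemma rat_expansion_sum:
  assumes "rat_expansion q d" "finite F" "F \<subseteq> {1..}" "{n. 1 \<le> n \<and> (d (- int n) \<noteq> 0 \<or> d (int n) \<noteq> 0)} \<subseteq> F"
  shows "q = (\<Sum>s\<in>F. of_int ((-1) ^ s * int (d (- int s))) / fact (s + 1))
           + of_int (\<Sum>r\<in>F. (-1) ^ (r + 1) * int (d (int r)) * fact r)"
proof -
  have "(\<Sum>s | 1 \<le> s \<and> d (- int s) \<noteq> 0. of_nat (d (- int s)) * ((-1) ^ s / fact (s + 1)))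
      = (\<Sum>s\<in>F. of_int ((-1) ^ s * int (d (- int s))) / fact (s + 1) :: rat)"
    using assms by (intro sum.mono_neutral_cong_left) auto
  moreover have "(\<Sum>r | 1 \<le> r \<and> d (int r) \<noteq> 0. of_nat (d (int r)) * ((-1) ^ (r + 1) * fact r))
      = (\<Sum>r\<in>F. of_int ((-1) ^ (r + 1) * int (d (int r)) * fact r) :: rat)"
    using assms by (intro sum.mono_neutral_cong_left) auto
  ultimately show ?thesis
    using assms(1) by (simp add: rat_expansion_def)
qed

text \<open>The difference of the fractional parts is minus that of the integer parts, hence an
  integer, so its coefficients vanish. The factorial sum is then zero and its coefficients vanish
  too.\<close>

lemma rat_expansion_unique:
  assumes "rat_expansion q d" "rat_expansion q d'"
  shows "d = d'"
proof
  define D where "D = {t. d t \<noteq> 0} \<union> {t. d' t \<noteq> 0}"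
  define F where "F = {n. 1 \<le> n \<and> (int n \<in> D \<or> - int n \<in> D)}"
  \<comment> \<open>The alternating signs are absorbed into the coefficients, which preserves the
    bounds by the index.\<close>
  define e where "e s = (-1) ^ s * (int (d (- int s)) - int (d' (- int s)))" for s
  define g where "g r = (-1) ^ (r + 1) * (int (d (int r)) - int (d' (int r)))" for r
  have "finite D" using assms by (simp add: D_def rat_expansion_def)
  moreover have "F \<subseteq> (nat \<circ> abs) ` D"
  proof
    fix n assume "n \<in> F"
    then show "n \<in> (nat \<circ> abs) ` D"
      by (cases "int n \<in> D") (auto simp: F_def intro: rev_image_eqI)
  qed
  ultimately have F: "finite F" by (meson finite_imageI finite_subset)
  have F1: "F \<subseteq> {1..}" by (auto simp: F_def)
  have dF: "{n. 1 \<le> n \<and> (d (- int n) \<noteq> 0 \<or> d (int n) \<noteq> 0)} \<subseteq> F"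
    "{n. 1 \<le> n \<and> (d' (- int n) \<noteq> 0 \<or> d' (int n) \<noteq> 0)} \<subseteq> F"
    by (auto simp: F_def D_def)
  have eq: "(\<Sum>s\<in>F. of_int (e s) / fact (s + 1)) + of_int (\<Sum>r\<in>F. g r * fact r) = (0 :: rat)"
    using rat_expansion_sum[OF assms(1) F F1 dF(1)] rat_expansion_sum[OF assms(2) F F1 dF(2)]
    unfolding e_def g_def
    by (simp add: sum_subtractf sum_negf algebra_simps diff_divide_distrib del: fact_Suc)
  have bound: "d (- int s) \<le> s" "d' (- int s) \<le> s" "d (int s) \<le> s" "d' (int s) \<le> s"
    if "s \<in> F" for s
    using assms that F1 by (auto simp: rat_expansion_def)
  have "\<bar>e s\<bar> \<le> int s" if "s \<in> F" for s
    using bound[OF that] by (auto simp: e_def abs_mult)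
  moreover have "(\<Sum>s\<in>F. of_int (e s) / fact (s + 1)) = (of_int (- (\<Sum>r\<in>F. g r * fact r)) :: rat)"
    using eq by linarith
  then have "(\<Sum>s\<in>F. of_int (e s) / fact (s + 1) :: rat) \<in> \<int>"
    by (simp only: Ints_of_int)
  ultimately have e: "\<forall>s\<in>F. e s = 0"
    using digits_zero_of_fractional_sum[OF F] by blast
  with eq have "(\<Sum>r\<in>F. g r * fact r) = 0"
    by (simp del: of_int_sum of_int_mult)
  moreover have "\<bar>g r\<bar> \<le> int r" if "r \<in> F" for r
    using bound[OF that] by (auto simp: g_def abs_mult)
  ultimately have g: "\<forall>r\<in>F. g r = 0"
    using digits_zero_of_factorial_sum[OF F] by blast
  fix t :: int
  show "d t = d' t"
  proof (cases "nat \<bar>t\<bar> \<in> F")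
    case True
    then show ?thesis
      using e g by (cases "t \<ge> 0") (fastforce simp: e_def g_def)+
  next
    case False
    then have "t = 0 \<or> t \<notin> D"
      by (cases "t \<ge> 0") (auto simp: F_def)
    then show ?thesis
      using assms by (auto simp: D_def rat_expansion_def)
  qed
qed

section \<open>The numbers \<beta> and \<gamma> and their digits\<close>

definition frac_sum :: "nat set \<Rightarrow> rat" where
  "frac_sum F = (\<Sum>s\<in>F. (-1) ^ s / fact (s + 1))"

definition int_sum :: "nat set \<Rightarrow> rat" where
  "int_sum F = (\<Sum>r\<in>F. (-1) ^ (r + 1) * fact r)"

text \<open>The expected digits of \<open>of_nat p * frac_sum F + of_nat q * int_sum F\<close>. The
  strict sign tests give digit 0 at \<open>t = 0\<close> whatever \<open>F\<close> contains.\<close>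

definition two_digits :: "nat set \<Rightarrow> nat \<Rightarrow> nat \<Rightarrow> int \<Rightarrow> nat" where
  "two_digits F p q t =
     (if t < 0 \<and> nat (- t) \<in> F then p else if t > 0 \<and> nat t \<in> F then q else 0)"

text \<open>As \<open>F\<close> starts beyond \<open>p\<close> and \<open>q\<close>, no carries occur.\<close>

lemma rat_expansion_two_digits:
  assumes "finite F" "\<And>n. n \<in> F \<Longrightarrow> 1 \<le> n \<and> p \<le> n \<and> q \<le> n"
  shows "rat_expansion (of_nat p * frac_sum F + of_nat q * int_sum F) (two_digits F p q)"
proof -
  have "{t. two_digits F p q t \<noteq> 0} \<subseteq> (\<lambda>n. - int n) ` F \<union> int ` F"
  proof
    fix t assume "t \<in> {t. two_digits F p q t \<noteq> 0}"
    then show "t \<in> (\<lambda>n. - int n) ` F \<union> int ` F"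
      by (cases "t < 0") (auto simp: two_digits_def image_iff split: if_splits intro!: bexI[of _ "nat \<bar>t\<bar>"])
  qed
  then have fin: "finite {t. two_digits F p q t \<noteq> 0}"
    using assms(1) by (meson finite_UnI finite_imageI finite_subset)
  have 1: "two_digits F p q (- int s) = (if s \<in> F then p else 0)"
    "two_digits F p q (int s) = (if s \<in> F then q else 0)" if "1 \<le> s" for s
    using that by (auto simp: two_digits_def)
  have "of_nat p * frac_sum F = (\<Sum>s | 1 \<le> s \<and> two_digits F p q (- int s) \<noteq> 0.
      of_nat (two_digits F p q (- int s)) * ((-1) ^ s / fact (s + 1)))"
    unfolding frac_sum_def sum_distrib_left using assms
    by (intro sum.mono_neutral_cong_right) (auto simp: 1 split: if_splits)
  moreover have "of_nat q * int_sum F = (\<Sum>r | 1 \<le> r \<and> two_digits F p q (int r) \<noteq> 0.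
      of_nat (two_digits F p q (int r)) * ((-1) ^ (r + 1) * fact r))"
    unfolding int_sum_def sum_distrib_left using assms
    by (intro sum.mono_neutral_cong_right) (auto simp: 1 split: if_splits)
  ultimately show ?thesis
    unfolding rat_expansion_def using fin assms(2) by (auto simp: 1) (simp add: two_digits_def)
qed

text \<open>By uniqueness, exhibiting one expansion evaluates the definite description in
  \<open>rat_digit\<close>.\<close>

lemma rat_digit_eq: "rat_expansion q d \<Longrightarrow> rat_digit q = d"
  unfolding rat_digit_def using rat_expansion_unique by blast

text \<open>The coefficients \<open>(-1) ^ s\<close> have absolute value 1, which is at most
  \<open>s\<close>; an integral sum would force them to be zero.\<close>

lemma frac_sum_not_Ints:
  assumes "finite F" "F \<noteq> {}" "F \<subseteq> {1..}"
  shows "frac_sum F \<notin> \<int>"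
proof
  assume "frac_sum F \<in> \<int>"
  then have "(\<Sum>s\<in>F. of_int ((-1) ^ s) / fact (s + 1) :: rat) \<in> \<int>"
    by (simp add: frac_sum_def)
  then have "\<forall>s\<in>F. (-1 :: int) ^ s = 0"
    using assms by (intro digits_zero_of_fractional_sum) auto
  then show False using assms(2) by auto
qed

lemma int_sum_nonzero:
  assumes "finite F" "F \<noteq> {}" "F \<subseteq> {1..}"
  shows "int_sum F \<noteq> 0"
proof
  assume "int_sum F = 0"
  then have "of_int (\<Sum>r\<in>F. (-1) ^ (r + 1) * fact r) = (0 :: rat)"
    by (simp add: int_sum_def)
  then have "(\<Sum>r\<in>F. (-1) ^ (r + 1) * fact r) = (0 :: int)"
    by (simp only: of_int_eq_0_iff)
  then have "\<forall>r\<in>F. (-1 :: int) ^ (r + 1) = 0"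
    using assms by (intro digits_zero_of_factorial_sum) auto
  then show False using assms(2) by auto
qed

lemma int_sum_Ints: "int_sum F \<in> \<int>"
  unfolding int_sum_def by (intro Ints_sum Ints_mult Ints_power fact_in_Ints) auto

section \<open>Multiple recurrence for commuting families of maps\<close>

text \<open>The letter at position \<open>i\<close>, counted from 0, acts through
  \<open>C (N + i)\<close>, and the first letter acts last. A large \<open>N\<close> pushes all
  indices beyond a given bound.\<close>

fun word_map :: "(nat \<Rightarrow> 'j \<Rightarrow> 'a \<Rightarrow> 'a) \<Rightarrow> nat \<Rightarrow> 'j list \<Rightarrow> 'a \<Rightarrow> 'a" where
  "word_map C N [] x = x"
| "word_map C N (j # w) x = C N j (word_map C (Suc N) w x)"

lemma foldr_closed:
  assumes "\<And>n y. n \<in> set L \<Longrightarrow> y \<in> X \<Longrightarrow> f n y \<in> X" "z \<in> X"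
  shows "foldr f L z \<in> X"
  using assms by (induction L) auto

text \<open>Commutation is known only at points of \<open>X\<close>, so the induction also keeps the
  intermediate points in \<open>X\<close>.\<close>

lemma foldr_commute_point:
  assumes "\<And>n y. n \<in> set L \<Longrightarrow> y \<in> X \<Longrightarrow> f n y \<in> X"
    and "\<And>n y. n \<in> set L \<Longrightarrow> y \<in> X \<Longrightarrow> f n (g y) = g (f n y)" "z \<in> X"
  shows "foldr f L (g z) = g (foldr f L z)"
  using assms
proof (induction L)
  case (Cons n L)
  have "foldr f L z \<in> X"
    using Cons.prems by (intro foldr_closed) auto
  then have "f n (g (foldr f L z)) = g (f n (foldr f L z))"
    using Cons.prems(2) by simp
  moreover have "foldr f L (g z) = g (foldr f L z)"
    using Cons.prems by (intro Cons.IH) simp_all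
  ultimately show ?case by simp
qed simp

text \<open>The maps at constant positions commute past those at variable positions and are gathered
  in \<open>z\<close>, which therefore does not depend on the letter \<open>j\<close>. The list
  \<open>L\<close> holds the positions of the variable, shifted by \<open>N\<close>.\<close>

lemma word_map_fill:
  assumes closed: "\<And>n j y. n \<ge> M \<Longrightarrow> j \<in> J \<Longrightarrow> y \<in> X \<Longrightarrow> C n j y \<in> X"
    and commute: "\<And>n m i j y. n \<ge> M \<Longrightarrow> m \<ge> M \<Longrightarrow> i \<in> J \<Longrightarrow> j \<in> J \<Longrightarrow> y \<in> X \<Longrightarrow>
      C n i (C m j y) = C m j (C n i y)"
    and "x \<in> X" "N \<ge> M" "set v \<subseteq> insert None (Some ` J)"
  shows "\<exists>L z. sorted_wrt (<) L \<and> set L \<subseteq> {N..} \<and> (None \<in> set v \<longrightarrow> L \<noteq> []) \<and> z \<in> X \<and>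
    (\<forall>j\<in>J. word_map C N (fill j v) x = foldr (\<lambda>n. C n j) L z)"
  using assms(4,5)
proof (induction v arbitrary: N)
  case Nil
  show ?case
    by (rule exI[of _ "[]"], rule exI[of _ x]) (simp add: fill_def assms(3))
next
  case (Cons a v)
  have "M \<le> Suc N" "set v \<subseteq> insert None (Some ` J)"
    using Cons.prems by auto
  from Cons.IH[OF this]
  obtain L z where L: "sorted_wrt (<) L" "set L \<subseteq> {Suc N..}" "None \<in> set v \<longrightarrow> L \<noteq> []" "z \<in> X"
    and eq: "\<forall>j\<in>J. word_map C (Suc N) (fill j v) x = foldr (\<lambda>n. C n j) L z"
    by blast
  show ?case
  proof (cases a)
    case None
    have "sorted_wrt (<) (N # L)" "set (N # L) \<subseteq> {N..}" using L by auto
    moreover have "\<forall>j\<in>J. word_map C N (fill j (a # v)) x = foldr (\<lambda>n. C n j) (N # L) z"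
      using eq None by (simp add: fill_def)
    ultimately show ?thesis using L(4) by blast
  next
    case (Some i)
    then have i: "i \<in> J" using Cons.prems by auto
    have "word_map C N (fill j (a # v)) x = foldr (\<lambda>n. C n j) L (C N i z)" if j: "j \<in> J" for j
    proof -
      have "n \<ge> M" if "n \<in> set L" for n using that L(2) Cons.prems(1) by fastforce
      then have "foldr (\<lambda>n. C n j) L (C N i z) = C N i (foldr (\<lambda>n. C n j) L z)"
        using closed commute i j L(4) Cons.prems(1) by (intro foldr_commute_point[where X = X]) auto
      then show ?thesis using eq j Some by (simp add: fill_def)
    qed
    moreover have "C N i z \<in> X" using closed i L(4) Cons.prems(1) by blast
    moreover have "set L \<subseteq> {N..}" using L(2) by fastforce
    moreover have "None \<in> set (a # v) \<longrightarrow> L \<noteq> []" using L(3) Some by simp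
    ultimately show ?thesis using L(1) by blast
  qed
qed

text \<open>At a monochromatic variable word the points for all letters lie in one small ball;
  the one for the letter \<open>e\<close> acting trivially serves as \<open>x0\<close>.\<close>

lemma multiple_recurrence:
  fixes X :: "'a::metric_space set" and C :: "nat \<Rightarrow> 'j \<Rightarrow> 'a \<Rightarrow> 'a"
  assumes "compact X" "X \<noteq> {}" "finite J" "e \<in> J" "\<epsilon> > 0"
    and closed: "\<And>n j y. n \<ge> N \<Longrightarrow> j \<in> J \<Longrightarrow> y \<in> X \<Longrightarrow> C n j y \<in> X"
    and commute: "\<And>n m i j y. n \<ge> N \<Longrightarrow> m \<ge> N \<Longrightarrow> i \<in> J \<Longrightarrow> j \<in> J \<Longrightarrow> y \<in> X \<Longrightarrow>
      C n i (C m j y) = C m j (C n i y)"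
    and triv: "\<And>n y. C n e y = y"
  shows "\<exists>L x0. sorted_wrt (<) L \<and> set L \<subseteq> {N..} \<and> L \<noteq> [] \<and> x0 \<in> X \<and>
    (\<forall>j\<in>J. foldr (\<lambda>n. C n j) L x0 \<in> X \<inter> ball x0 \<epsilon>)"
proof -
  obtain x where x: "x \<in> X" using assms(2) by blast
  \<comment> \<open>Half the radius ensures that two points of one ball are less than \<epsilon>
    apart.\<close>
  obtain K where K: "finite K" "X \<subseteq> (\<Union>k\<in>K. ball k (\<epsilon> / 2))"
    using seq_compact_imp_totally_bounded assms(1,5) by (metis compact_imp_seq_compact half_gt_zero)
  define c where "c w = (SOME k. k \<in> K \<and> word_map C N w x \<in> ball k (\<epsilon> / 2))" for w
  have word_X: "word_map C n w x \<in> X" if "n \<ge> N" "set w \<subseteq> J" for n w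
    using that by (induction w arbitrary: n) (auto simp: x closed)
  have c: "c w \<in> K \<and> word_map C N w x \<in> ball (c w) (\<epsilon> / 2)" if "set w \<subseteq> J" for w
  proof -
    have "\<exists>k. k \<in> K \<and> word_map C N w x \<in> ball k (\<epsilon> / 2)"
      using word_X[OF order_refl that] K(2) by blast
    then show ?thesis unfolding c_def by (rule someI_ex)
  qed
  obtain m where m: "hales_jewett J (card K) m"
    using hales_jewett_theorem[OF assms(3)] assms(4) by blast
  have "c ` words J m \<subseteq> K" using c by (auto simp: words_def)
  from hales_jewett_finite_range[OF m K(1) this] obtain v
    where v: "v \<in> variable_words J m" "monochromatic J c v" by blast
  have "set v \<subseteq> insert None (Some ` J)" "None \<in> set v"
    using v(1) by (auto simp: variable_words_def)
  then obtain L z where L: "sorted_wrt (<) L" "set L \<subseteq> {N..}" "L \<noteq> []" "z \<in> X"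
    and eq: "\<forall>j\<in>J. word_map C N (fill j v) x = foldr (\<lambda>n. C n j) L z"
    using word_map_fill[where J = J and X = X and C = C and M = N, OF closed commute x order_refl]
    by blast
  have z: "foldr (\<lambda>n. C n e) L z = z"
    by (induction L) (simp_all add: triv)
  have "foldr (\<lambda>n. C n j) L z \<in> X \<inter> ball z \<epsilon>" if j: "j \<in> J" for j
  proof -
    have f: "set (fill j v) \<subseteq> J" "set (fill e v) \<subseteq> J"
      using fill_in_words[OF v(1)] j assms(4) by (auto simp: words_def)
    have "c (fill j v) = c (fill e v)"
      using v(2) j assms(4) unfolding monochromatic_def by blast
    then have "foldr (\<lambda>n. C n j) L z \<in> ball (c (fill e v)) (\<epsilon> / 2)" "z \<in> ball (c (fill e v)) (\<epsilon> / 2)"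
      using c[OF f(1)] c[OF f(2)] eq j assms(4) z by auto
    then have "dist z (foldr (\<lambda>n. C n j) L z) < \<epsilon>"
      by (auto intro: dist_triangle_half_r)
    moreover have "foldr (\<lambda>n. C n j) L z \<in> X"
      using eq j word_X[OF order_refl f(1)] by simp
    ultimately show ?thesis by simp
  qed
  with L show ?thesis by (intro exI[of _ L] exI[of _ z]) simp
qed

section \<open>The action of p \<beta> + q \<gamma>\<close>

lemma rat_family_foldr:
  "rat_family T q x = foldr (\<lambda>t. T t ^^ rat_digit q t) (sorted_list_of_set (rat_dom q)) x"
proof -
  have "foldr (\<lambda>t f. (T t ^^ rat_digit q t) \<circ> f) xs id x = foldr (\<lambda>t. T t ^^ rat_digit q t) xs x" for xs
    by (induction xs) simp_all
  then show ?thesis by (simp add: rat_family_def)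
qed

text \<open>Indices with digit 0 contribute identity maps; putting them back lets one list of
  indices serve also when \<open>p\<close> or \<open>q\<close> is 0.\<close>

lemma foldr_filter_trivial:
  assumes "\<And>t y. \<not> P t \<Longrightarrow> h t y = y"
  shows "foldr h (filter P xs) x = foldr h xs x"
  using assms by (induction xs) auto

text \<open>This turns the increasing order of \<open>rat_family\<close> into a grouping by pairs.
  The head \<open>n\<close> of \<open>L\<close> puts the adjacent indices \<open>- int n\<close> and
  \<open>int n\<close> in the middle of the list; as a pair they commute past the negative indices
  to their left.\<close>

lemma foldr_reflected:
  assumes closed: "\<And>t y. t \<noteq> 0 \<Longrightarrow> y \<in> X \<Longrightarrow> h t y \<in> X"
    and commute: "\<And>s t y. s \<noteq> 0 \<Longrightarrow> t \<noteq> 0 \<Longrightarrow> y \<in> X \<Longrightarrow> h s (h t y) = h t (h s y)"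
    and "x \<in> X" "0 \<notin> set L"
  shows "foldr h (rev (map (\<lambda>n. - int n) L) @ map int L) x =
    foldr (\<lambda>n y. h (- int n) (h (int n) y)) L x"
  using assms(4)
proof (induction L)
  case (Cons n L)
  let ?xs = "rev (map (\<lambda>n. - int n) L)"
  define z where "z = foldr h (map int L) x"
  have nz: "n \<noteq> 0" "0 \<notin> set L" using Cons.prems by auto
  have xs: "t \<noteq> 0" if "t \<in> set ?xs" for t using that nz(2) by auto
  have z: "z \<in> X"
    unfolding z_def using nz(2) assms(3) by (intro foldr_closed) (auto intro!: closed)
  have "foldr h ?xs (h (- int n) (h (int n) z)) = h (- int n) (h (int n) (foldr h ?xs z))"
    using xs z nz(1)
    by (intro foldr_commute_point[where X = X and g = "\<lambda>y. h (- int n) (h (int n) y)"])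
      (simp_all add: closed commute)
  also have "foldr h ?xs z = foldr (\<lambda>n y. h (- int n) (h (int n) y)) L x"
    using Cons.IH nz(2) by (simp add: z_def)
  finally show ?case by (simp add: z_def)
qed simp

lemma funpow_closed: "(\<And>y. y \<in> X \<Longrightarrow> f y \<in> X) \<Longrightarrow> x \<in> X \<Longrightarrow> (f ^^ n) x \<in> X"
  by (induction n) auto

lemma funpow_commute_left:
  assumes "\<And>y. y \<in> X \<Longrightarrow> f y \<in> X" "\<And>y. y \<in> X \<Longrightarrow> f (g y) = g (f y)" "x \<in> X"
  shows "(f ^^ n) (g x) = g ((f ^^ n) x)"
proof (induction n)
  case (Suc n)
  have "(f ^^ n) x \<in> X" using assms(1,3) by (rule funpow_closed)
  then show ?case using Suc assms(2) by simp
qed simp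

lemma funpow_commute:
  assumes "\<And>y. y \<in> X \<Longrightarrow> f y \<in> X" "\<And>y. y \<in> X \<Longrightarrow> g y \<in> X"
    and "\<And>y. y \<in> X \<Longrightarrow> f (g y) = g (f y)" "x \<in> X"
  shows "(f ^^ m) ((g ^^ n) x) = (g ^^ n) ((f ^^ m) x)"
proof (rule funpow_commute_left[of X f])
  fix y assume y: "y \<in> X"
  show "f ((g ^^ n) y) = (g ^^ n) (f y)"
    by (rule funpow_commute_left[of X g f y n, symmetric]) (use assms y in auto)
qed (use assms in auto)

text \<open>As \<open>L\<close> is positive and strictly increasing, its reversed negatives followed
  by \<open>L\<close> are strictly increasing, and such a list is determined by its set. The filter
  takes effect when \<open>p\<close> or \<open>q\<close> is 0.\<close>

lemma sorted_list_of_two_digits_dom: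
  assumes "sorted_wrt (<) L" "0 \<notin> set L"
  shows "sorted_list_of_set {t. t \<noteq> 0 \<and> two_digits (set L) p q t \<noteq> 0} =
    filter (\<lambda>t. two_digits (set L) p q t \<noteq> 0) (rev (map (\<lambda>n. - int n) L) @ map int L)"
    (is "_ = filter ?P ?M")
proof -
  have "- int m < int n" if "m \<in> set L" for m n
    using that assms(2) by (cases "m = 0") simp_all
  then have "sorted_wrt (<) ?M"
    using assms(1) by (auto simp: sorted_wrt_append sorted_wrt_rev sorted_wrt_map)
  then have "sorted_wrt (<) (filter ?P ?M)" by (rule sorted_wrt_filter)
  moreover have "set (filter ?P ?M) = {t. t \<noteq> 0 \<and> ?P t}"
  proof (intro equalityI subsetI)
    fix t assume "t \<in> {t. t \<noteq> 0 \<and> ?P t}"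
    then have t: "t \<noteq> 0" "?P t" by auto
    then have "nat \<bar>t\<bar> \<in> set L"
      by (cases "t < 0") (simp_all add: two_digits_def split: if_splits)
    moreover have "t = - int (nat \<bar>t\<bar>) \<or> t = int (nat \<bar>t\<bar>)" by linarith
    ultimately have "t \<in> (\<lambda>n. - int n) ` set L \<or> t \<in> int ` set L" by blast
    then show "t \<in> set (filter ?P ?M)" using t by simp
  next
    fix t assume "t \<in> set (filter ?P ?M)"
    then show "t \<in> {t. t \<noteq> 0 \<and> ?P t}" using assms(2) by auto
  qed
  ultimately show ?thesis
    using sorted_list_of_set.idem_if_sorted_distinct[of "filter ?P ?M"]
    by (simp only: strict_sorted_iff)
qed

text \<open>Without carries the digits are \<open>p\<close> at \<open>- int n\<close> and
  \<open>q\<close> at \<open>int n\<close>; after zero digits are put back,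
  \<open>foldr_reflected\<close> pairs the powers.\<close>

lemma rat_family_two_digits:
  assumes L: "sorted_wrt (<) L" "\<And>n. n \<in> set L \<Longrightarrow> 1 \<le> n \<and> p \<le> n \<and> q \<le> n"
    and closed: "\<And>t y. t \<noteq> 0 \<Longrightarrow> y \<in> X \<Longrightarrow> T t y \<in> X"
    and commute: "\<And>s t y. s \<noteq> 0 \<Longrightarrow> t \<noteq> 0 \<Longrightarrow> y \<in> X \<Longrightarrow> T s (T t y) = T t (T s y)"
    and x: "x \<in> X"
  shows "rat_family T (of_nat p * frac_sum (set L) + of_nat q * int_sum (set L)) x =
    foldr (\<lambda>n y. (T (- int n) ^^ p) ((T (int n) ^^ q) y)) L x"
proof -
  let ?d = "two_digits (set L) p q"
  let ?q = "of_nat p * frac_sum (set L) + of_nat q * int_sum (set L)"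
  have digit: "rat_digit ?q = ?d"
    using L(2) by (intro rat_digit_eq rat_expansion_two_digits) auto
  have L0: "0 \<notin> set L" using L(2) by fastforce
  have "rat_family T ?q x = foldr (\<lambda>t. T t ^^ ?d t) (rev (map (\<lambda>n. - int n) L) @ map int L) x"
    unfolding rat_family_foldr rat_dom_def digit sorted_list_of_two_digits_dom[OF L(1) L0]
    by (rule foldr_filter_trivial) simp
  also have "\<dots> = foldr (\<lambda>n y. (T (- int n) ^^ ?d (- int n)) ((T (int n) ^^ ?d (int n)) y)) L x"
  proof (rule foldr_reflected[where X = X])
    fix s t :: int and y assume nz: "s \<noteq> 0" "t \<noteq> 0" and y: "y \<in> X"
    show "(T t ^^ ?d t) y \<in> X"
      using closed[OF nz(2)] y by (rule funpow_closed)
    show "(T s ^^ ?d s) ((T t ^^ ?d t) y) = (T t ^^ ?d t) ((T s ^^ ?d s) y)"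
      using closed[OF nz(1)] closed[OF nz(2)] commute[OF nz] y by (rule funpow_commute)
  qed (use x L0 in auto)
  also have "\<dots> = foldr (\<lambda>n y. (T (- int n) ^^ p) ((T (int n) ^^ q) y)) L x"
    using L0 by (intro foldr_cong) (auto simp: two_digits_def)
  finally show ?thesis .
qed

text \<open>The case \<open>p = 1\<close>, \<open>q = 0\<close> of
  \<open>two_digits\<close>.\<close>

lemma rat_dom_frac_sum:
  assumes "finite F" "\<And>n. n \<in> F \<Longrightarrow> 1 \<le> n"
  shows "rat_dom (frac_sum F) = (\<lambda>n. - int n) ` F"
proof -
  have "rat_digit (frac_sum F) = two_digits F 1 0"
    using rat_expansion_two_digits[of F 1 0] assms by (intro rat_digit_eq) simp
  then have "t \<in> rat_dom (frac_sum F) \<longleftrightarrow> t < 0 \<and> nat (- t) \<in> F" for t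
    by (simp add: rat_dom_def two_digits_def)
  moreover have "t < 0 \<and> nat (- t) \<in> F \<longleftrightarrow> t \<in> (\<lambda>n. - int n) ` F" for t
  proof
    assume "t < 0 \<and> nat (- t) \<in> F"
    then show "t \<in> (\<lambda>n. - int n) ` F" by (intro image_eqI[of _ _ "nat (- t)"]) simp_all
  next
    assume "t \<in> (\<lambda>n. - int n) ` F"
    then obtain n where "n \<in> F" "t = - int n" by (rule imageE)
    then show "t < 0 \<and> nat (- t) \<in> F" using assms(2)[of n] by simp
  qed
  ultimately show ?thesis by blast
qed

lemma rat_dom_int_sum:
  assumes "finite F" "\<And>n. n \<in> F \<Longrightarrow> 1 \<le> n"
  shows "rat_dom (int_sum F) = int ` F"
proof -
  have "rat_digit (int_sum F) = two_digits F 0 1"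
    using rat_expansion_two_digits[of F 0 1] assms by (intro rat_digit_eq) simp
  then have "t \<in> rat_dom (int_sum F) \<longleftrightarrow> t > 0 \<and> nat t \<in> F" for t
    by (auto simp: rat_dom_def two_digits_def)
  moreover have "t > 0 \<and> nat t \<in> F \<longleftrightarrow> t \<in> int ` F" for t
  proof
    assume "t > 0 \<and> nat t \<in> F"
    then show "t \<in> int ` F" by (intro image_eqI[of _ _ "nat t"]) simp_all
  next
    assume "t \<in> int ` F"
    then obtain n where "n \<in> F" "t = int n" by (rule imageE)
    then show "t > 0 \<and> nat t \<in> F" using assms(2)[of n] by simp
  qed
  ultimately show ?thesis by blast
qed

section \<open>Recurrence in a rational dynamical system\<close>

theorem theorem3p1:
  fixes X :: "'a::metric_space set"
    and T :: "nat \<Rightarrow> int \<Rightarrow> 'a \<Rightarrow> 'a"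
    and l k :: nat
    and k1 k2 \<epsilon> :: real
  assumes "l \<ge> 1"
    and "rational_dynamical_system X l T"
    and "k \<ge> 1"
    and "k1 < k2"
    and "\<epsilon> > 0"
  shows "\<exists>(\<beta>::rat) (\<gamma>::rat). \<beta> \<notin> \<int> \<and> \<gamma> \<in> \<int> \<and> \<gamma> \<noteq> 0 \<and>
    rat_dom_pos \<beta> = {} \<and> rat_dom_neg \<gamma> = {} \<and>
    of_int (Max (rat_dom_neg \<beta>)) < k1 \<and> k2 < of_int (Min (rat_dom_pos \<gamma>)) \<and>
    (\<exists>x0\<in>X. \<forall>p q :: nat. p \<le> k \<longrightarrow> q \<le> k \<longrightarrow> (\<forall>i\<in>{1..l}.
       rat_family (T i) (of_nat p * \<beta> + of_nat q * \<gamma>) x0 \<in> X \<inter> ball x0 \<epsilon>))"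
proof -
  have X: "X \<noteq> {}" "compact X"
    using assms(2) by (simp_all add: rational_dynamical_system_def)
  have T: "T i n y \<in> X" if "i \<in> {1..l}" "n \<noteq> 0" "y \<in> X" for i n y
    using assms(2) that unfolding rational_dynamical_system_def homeomorphism_def by blast
  have comm: "T i m (T j n y) = T j n (T i m y)"
    if "i \<in> {1..l}" "j \<in> {1..l}" "m \<noteq> 0" "n \<noteq> 0" "y \<in> X" for i j m n y
    using assms(2) that unfolding rational_dynamical_system_def by blast
  \<comment> \<open>The summand \<open>k\<close> prevents carries, the ceilings handle
    \<open>k1\<close> and \<open>k2\<close>, and the final 1 makes these bounds strict and the
    indices positive.\<close>
  define N where "N = k + nat \<lceil>\<bar>k1\<bar>\<rceil> + nat \<lceil>\<bar>k2\<bar>\<rceil> + 1"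
  have N: "k \<le> n" "1 \<le> n" "\<bar>k1\<bar> < real n" "\<bar>k2\<bar> < real n" if "n \<ge> N" for n
    using that real_nat_ceiling_ge[of "\<bar>k1\<bar>"] real_nat_ceiling_ge[of "\<bar>k2\<bar>"]
    unfolding N_def by linarith+
  define J where "J = {1..l} \<times> {..k} \<times> {..k}"
  define C where "C n = (\<lambda>(i, p, q) y. (T i (- int n) ^^ p) ((T i (int n) ^^ q) y))" for n
  have closed: "C n j y \<in> X" if "n \<ge> N" "j \<in> J" "y \<in> X" for n j y
    using that N(2)[of n] by (auto simp: C_def J_def intro!: funpow_closed T)
  have pow: "(T i m ^^ p) ((T j n ^^ q) y) = (T j n ^^ q) ((T i m ^^ p) y)" "(T i m ^^ p) y \<in> X"
    if "i \<in> {1..l}" "j \<in> {1..l}" "m \<noteq> 0" "n \<noteq> 0" "y \<in> X" for i j m n p q y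
    subgoal
      using T[OF that(1,3)] T[OF that(2,4)] comm[OF that(1-4)] that(5) by (rule funpow_commute)
    subgoal
      using T[OF that(1,3)] that(5) by (rule funpow_closed)
    done
  \<comment> \<open>Letters with different first components may occur in one word, so commutation
    across the families \<open>T i\<close> is used here.\<close>
  have commute: "C n a (C m b y) = C m b (C n a y)"
    if nm: "n \<ge> N" "m \<ge> N" and ab: "a \<in> J" "b \<in> J" and y: "y \<in> X" for n m a b y
  proof -
    obtain i p q i' p' q' where a: "a = (i, p, q)" "i \<in> {1..l}" and b: "b = (i', p', q')" "i' \<in> {1..l}"
      using ab by (auto simp: J_def)
    have nz: "int n \<noteq> 0" "- int n \<noteq> 0" "int m \<noteq> 0" "- int m \<noteq> 0"
      using N(2) nm by fastforce+
    define A A' B B' where "A = T i (- int n) ^^ p" and "A' = T i (int n) ^^ q"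
      and "B = T i' (- int m) ^^ p'" and "B' = T i' (int m) ^^ q'"
    have in_X: "A z \<in> X" "A' z \<in> X" "B z \<in> X" "B' z \<in> X" if "z \<in> X" for z
      unfolding A_def A'_def B_def B'_def using that a b nz pow(2) by blast+
    have c: "A (B z) = B (A z)" "A (B' z) = B' (A z)" "A' (B z) = B (A' z)" "A' (B' z) = B' (A' z)"
      if "z \<in> X" for z
      unfolding A_def A'_def B_def B'_def using that a b nz pow(1) by blast+
    have "A (A' (B (B' y))) = B (B' (A (A' y)))"
      using y by (simp add: c in_X)
    then show ?thesis
      by (simp add: a b C_def A_def A'_def B_def B'_def)
  qed
  \<comment> \<open>The trivial letter lies in \<open>J\<close> because
    \<open>l \<ge> 1\<close>.\<close>
  have J: "finite J" "(1, 0, 0) \<in> J" and triv: "C n (1, 0, 0) y = y" for n y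
    using assms(1) by (simp_all add: J_def C_def)
  have "\<exists>L x0. sorted_wrt (<) L \<and> set L \<subseteq> {N..} \<and> L \<noteq> [] \<and> x0 \<in> X \<and>
    (\<forall>j\<in>J. foldr (\<lambda>n. C n j) L x0 \<in> X \<inter> ball x0 \<epsilon>)"
    by (rule multiple_recurrence[where C = C and N = N, OF X(2,1) J assms(5)])
      (rule closed commute triv; assumption)+
  then obtain L x0 where L: "sorted_wrt (<) L" "set L \<subseteq> {N..}" "L \<noteq> []" and x0: "x0 \<in> X"
    and rec: "\<forall>j\<in>J. foldr (\<lambda>n. C n j) L x0 \<in> X \<inter> ball x0 \<epsilon>"
    by blast
  let ?\<beta> = "frac_sum (set L)" and ?\<gamma> = "int_sum (set L)"
  have L1: "1 \<le> n" if "n \<in> set L" for n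
    using that L(2) N(2) by blast
  have dom: "rat_dom ?\<beta> = (\<lambda>n. - int n) ` set L" "rat_dom ?\<gamma> = int ` set L"
    using L1 by (simp_all add: rat_dom_frac_sum rat_dom_int_sum)
  have neg: "rat_dom_neg ?\<beta> = (\<lambda>n. - int n) ` set L" and "rat_dom_pos ?\<beta> = {}"
    unfolding rat_dom_neg_def rat_dom_pos_def dom using L1 by fastforce+
  moreover have pos: "rat_dom_pos ?\<gamma> = int ` set L" and "rat_dom_neg ?\<gamma> = {}"
    unfolding rat_dom_neg_def rat_dom_pos_def dom using L1 by fastforce+
  moreover have "?\<beta> \<notin> \<int>" "?\<gamma> \<noteq> 0"
    using L1 L(3) by (intro frac_sum_not_Ints int_sum_nonzero; auto)+
  \<comment> \<open>The maximum is attained at some \<open>- int n\<close> with \<open>n\<close> in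
    \<open>L\<close>, and \<open>n\<close> exceeds the absolute value of \<open>k1\<close>.\<close>
  moreover have "of_int (Max (rat_dom_neg ?\<beta>)) < k1"
  proof -
    have "Max (rat_dom_neg ?\<beta>) \<in> (\<lambda>n. - int n) ` set L"
      unfolding neg using L(3) by (intro Max_in) auto
    then obtain n where "n \<in> set L" "Max (rat_dom_neg ?\<beta>) = - int n" by blast
    then show ?thesis using N(3)[of n] L(2) by auto
  qed
  moreover have "k2 < of_int (Min (rat_dom_pos ?\<gamma>))"
  proof -
    have "Min (rat_dom_pos ?\<gamma>) \<in> int ` set L"
      unfolding pos using L(3) by (intro Min_in) auto
    then obtain n where "n \<in> set L" "Min (rat_dom_pos ?\<gamma>) = int n" by blast
    then show ?thesis using N(4)[of n] L(2) by auto
  qed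
  moreover have "rat_family (T i) (of_nat p * ?\<beta> + of_nat q * ?\<gamma>) x0 \<in> X \<inter> ball x0 \<epsilon>"
    if pq: "p \<le> k" "q \<le> k" and i: "i \<in> {1..l}" for p q i
  proof -
    \<comment> \<open>Every index in \<open>L\<close> is at least \<open>N\<close>, hence at least
      \<open>k\<close>, so \<open>p\<close> and \<open>q\<close> are admissible digits
      there.\<close>
    have "1 \<le> n \<and> p \<le> n \<and> q \<le> n" if "n \<in> set L" for n
      using that L1 N(1)[of n] L(2) pq by auto
    then have "rat_family (T i) (of_nat p * ?\<beta> + of_nat q * ?\<gamma>) x0 =
        foldr (\<lambda>n y. (T i (- int n) ^^ p) ((T i (int n) ^^ q) y)) L x0"
      using L(1) x0 i T comm by (intro rat_family_two_digits[where X = X]) auto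
    also have "\<dots> = foldr (\<lambda>n. C n (i, p, q)) L x0"
      by (simp add: C_def)
    finally show ?thesis
      using rec pq i by (simp add: J_def)
  qed
  ultimately show ?thesis
    using int_sum_Ints x0 by (intro exI[of _ ?\<beta>] exI[of _ ?\<gamma>] conjI bexI[of _ x0] allI impI ballI)
qed

end
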